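(* If $G$ is a $12$-representable graph, then $G$ is a comparability graph.
   Context: All graphs are simple and finite. For a word $w$ over the positive integers, $A(w)$ is the set of letters occurring in $w$; for $B\subseteq A(w)$, $w_B$ is the word obtained from $w$ by deleting all letters not in $B$. A word $w=w_1\cdots w_m$ has a $12$-match if $w_i<w_{i+1}$ for some $i$. A labeled graph $G=([n],E)$, with $[n]=\{1,\ldots,n\}$, is $12$-representable if there is a word $w\in[n]^*$ with $A(w)=[n]$ such that for all distinct $x,y\in[n]$: $xy\in E$ if and only if $w_{\{x,y\}}$ has no $12$-match. An unlabeled graph is $12$-representable if some labeling of its vertices by $[n]$ (where $n$ is the number of vertices) gives a $12$-representable labeled graph. A comparability graph is an undirected graph for which there is a partial order on the vertex set such that two distinct vertices are adjacent if and only if they are comparable; equivalently, a graph admitting a transitive orientation (an acyclic orientation such that whenever $a\to b$ and $b\to c$ are arcs, $a\to c$ is an arc). *)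

theory Defs
  imports Main
begin

definition simple_graph :: "'a set \<Rightarrow> 'a set set \<Rightarrow> bool" where
  "simple_graph V E \<longleftrightarrow> finite V \<and> (\<forall>e\<in>E. e \<subseteq> V \<and> card e = 2)"

definition word_restrict :: "nat list \<Rightarrow> nat set \<Rightarrow> nat list" where
  "word_restrict w B = filter (\<lambda>a. a \<in> B) w"

definition has_12_match :: "nat list \<Rightarrow> bool" where
  "has_12_match w \<longleftrightarrow> (\<exists>i. Suc i < length w \<and> w ! i < w ! Suc i)"

definition labeled_12_representable :: "nat \<Rightarrow> nat set set \<Rightarrow> bool" where
  "labeled_12_representable n E \<longleftrightarrow>
     simple_graph {1..n} E \<and>
     (\<exists>w. set w = {1..n} \<and>
        (\<forall>x\<in>{1..n}. \<forall>y\<in>{1..n}. x \<noteq> y \<longrightarrow>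
           ({x, y} \<in> E \<longleftrightarrow> \<not> has_12_match (word_restrict w {x, y}))))"

(* A labeling f renames every vertex, so the edge {u, v} becomes {f u, f v}. *)
definition graph_12_representable :: "'a set \<Rightarrow> 'a set set \<Rightarrow> bool" where
  "graph_12_representable V E \<longleftrightarrow>
     (\<exists>f. bij_betw f V {1..card V} \<and> labeled_12_representable (card V) ((`) f ` E))"

definition comparability_graph :: "'a set \<Rightarrow> 'a set set \<Rightarrow> bool" where
  "comparability_graph V E \<longleftrightarrow>
     simple_graph V E \<and>
     (\<exists>r. partial_order_on V r \<and>
        (\<forall>u\<in>V. \<forall>v\<in>V. u \<noteq> v \<longrightarrow>
           ({u, v} \<in> E \<longleftrightarrow> (u, v) \<in> r \<or> (v, u) \<in> r)))"

end

theory Submission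
  imports Defs
begin

text \<open>
  For letters \<open>x < y\<close>, the restriction of \<open>w\<close> to \<open>{x, y}\<close> has no 12-match exactly when it is weakly
  decreasing, that is, when every \<open>y\<close> stands before every \<open>x\<close> in \<open>w\<close>
  (\<open>no_12_match_iff\<close>). Orient every edge from its smaller to its larger label. If \<open>x < y < z\<close>, all
  occurrences of \<open>z\<close> precede all those of \<open>y\<close>, and all those of \<open>y\<close> precede all those of \<open>x\<close>, then
  all occurrences of \<open>z\<close> precede all those of \<open>x\<close>, because \<open>y\<close> does occur in \<open>w\<close>. So this
  orientation is transitive (\<open>never_before_trans\<close>). Pulled back along the labeling, its reflexive
  closure is the required partial order.
\<close>

definition never_before :: "'a list \<Rightarrow> 'a \<Rightarrow> 'a \<Rightarrow> bool" where
  "never_before w x y \<longleftrightarrow> (\<forall>i j. i < j \<longrightarrow> j < length w \<longrightarrow> \<not> (w ! i = x \<and> w ! j = y))"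

text \<open>
  If some \<open>x\<close> stood before some \<open>z\<close>, any occurrence of \<open>y\<close> would lie after that \<open>x\<close> or before
  that \<open>z\<close>, and either is excluded. The middle letter has to occur in \<open>w\<close>: otherwise both
  relations to it hold vacuously.
\<close>

lemma never_before_trans:
  assumes xy: "never_before w x y" and yz: "never_before w y z"
    and y: "y \<in> set w"
  shows "never_before w x z"
  unfolding never_before_def
proof (intro allI impI notI)
  fix i j assume ij: "i < j" "j < length w" and "w ! i = x \<and> w ! j = z"
  moreover from y obtain k where k: "k < length w" "w ! k = y"
    by (auto simp: in_set_conv_nth)
  moreover have "i < k \<or> k < j" using ij by linarith
  ultimately show False
    using xy yz unfolding never_before_def by blast
qed

lemma sorted_wrt_filter_iff:
  "sorted_wrt P (filter Q xs) \<longleftrightarrow> sorted_wrt (\<lambda>a b. Q a \<longrightarrow> Q b \<longrightarrow> P a b) xs"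
  by (induction xs) auto

text \<open>Comparing neighbours suffices to test for a decreasing word because \<open>\<ge>\<close> is transitive.\<close>

lemma not_has_12_match_iff_sorted:
  "\<not> has_12_match w \<longleftrightarrow> sorted_wrt (\<ge>) w"
proof -
  have "transp ((\<ge>) :: nat \<Rightarrow> nat \<Rightarrow> bool)" by (auto intro: transpI)
  then show ?thesis
    unfolding has_12_match_def sorted_wrt_iff_nth_Suc_transp[OF \<open>transp _\<close>]
    by (meson not_less)
qed

lemma no_12_match_iff:
  assumes "x < y"
  shows "\<not> has_12_match (word_restrict w {x, y}) \<longleftrightarrow> never_before w x y"
proof -
  have "(a \<in> {x, y} \<longrightarrow> b \<in> {x, y} \<longrightarrow> a \<ge> b) \<longleftrightarrow> \<not> (a = x \<and> b = y)" for a b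
    using assms by auto
  then have "\<not> has_12_match (word_restrict w {x, y}) \<longleftrightarrow> sorted_wrt (\<lambda>a b. \<not> (a = x \<and> b = y)) w"
    by (simp only: not_has_12_match_iff_sorted word_restrict_def sorted_wrt_filter_iff)
  then show ?thesis
    by (simp only: never_before_def sorted_wrt_iff_nth_less)
qed

lemma image_edge_iff:
  assumes "inj_on f V" and "\<forall>e\<in>E. e \<subseteq> V" and "u \<in> V" and "v \<in> V"
  shows "{f u, f v} \<in> (`) f ` E \<longleftrightarrow> {u, v} \<in> E"
proof
  assume "{f u, f v} \<in> (`) f ` E"
  then obtain e where e: "e \<in> E" "f ` {u, v} = f ` e" by auto
  then have "{u, v} = e"
    using assms inj_on_image_eq_iff[of f V "{u, v}" e] by auto
  with e show "{u, v} \<in> E" by simp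
next
  assume "{u, v} \<in> E"
  then have "f ` {u, v} \<in> (`) f ` E" by (rule imageI)
  then show "{f u, f v} \<in> (`) f ` E" by simp
qed

theorem theorem11:
  fixes V :: "'a set" and E :: "'a set set"
  assumes "simple_graph V E"
    and "graph_12_representable V E"
  shows "comparability_graph V E"
proof -
  let ?L = "{1..card V}"
  from assms(2) obtain f w where f: "bij_betw f V ?L" and w: "set w = ?L"
    and rep: "\<forall>x\<in>?L. \<forall>y\<in>?L. x \<noteq> y \<longrightarrow>
      ({x, y} \<in> (`) f ` E \<longleftrightarrow> \<not> has_12_match (word_restrict w {x, y}))"
    unfolding graph_12_representable_def labeled_12_representable_def by blast
  have inj: "inj_on f V" and fL: "\<And>v. v \<in> V \<Longrightarrow> f v \<in> ?L"
    using f by (auto simp: bij_betw_def)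
  have subV: "\<forall>e\<in>E. e \<subseteq> V" using assms(1) by (simp add: simple_graph_def)
  have edge: "{u, v} \<in> E \<longleftrightarrow> never_before w (f u) (f v)"
    if "u \<in> V" "v \<in> V" "f u < f v" for u v
  proof -
    have "{u, v} \<in> E \<longleftrightarrow> {f u, f v} \<in> (`) f ` E"
      using image_edge_iff[OF inj subV that(1,2)] by simp
    also have "\<dots> \<longleftrightarrow> \<not> has_12_match (word_restrict w {f u, f v})"
      using rep[rule_format, OF fL[OF that(1)] fL[OF that(2)]] that(3) by simp
    finally show ?thesis using no_12_match_iff[OF that(3)] by simp
  qed
  define r where
    "r = {(u, v). u \<in> V \<and> v \<in> V \<and> (u = v \<or> f u < f v \<and> never_before w (f u) (f v))}"
  have "trans r"
  proof (rule transI)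
    fix a b c assume ab: "(a, b) \<in> r" and bc: "(b, c) \<in> r"
    show "(a, c) \<in> r"
    proof (cases "a = b \<or> b = c")
      case True
      then show ?thesis using ab bc by auto
    next
      case False
      then have *: "a \<in> V" "b \<in> V" "c \<in> V" "f a < f b" "f b < f c"
        "never_before w (f a) (f b)" "never_before w (f b) (f c)"
        using ab bc by (auto simp: r_def)
      then have "never_before w (f a) (f c)"
        using never_before_trans[of w "f a" "f b" "f c"] fL w by auto
      then show ?thesis using * by (auto simp: r_def)
    qed
  qed
  then have "partial_order_on V r"
    by (auto simp: partial_order_on_def preorder_on_def refl_on_def antisym_def r_def)
  moreover have "{u, v} \<in> E \<longleftrightarrow> (u, v) \<in> r \<or> (v, u) \<in> r"
    if uv: "u \<in> V" "v \<in> V" "u \<noteq> v" for u v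
  proof -
    have "f u \<noteq> f v" using inj uv by (auto dest: inj_onD)
    then consider "f u < f v" | "f v < f u" by linarith
    then show ?thesis
    proof cases
      case 1
      then show ?thesis using edge[of u v] uv by (auto simp: r_def)
    next
      case 2
      then show ?thesis using edge[of v u] uv by (auto simp: r_def insert_commute)
    qed
  qed
  ultimately show ?thesis
    using assms(1) unfolding comparability_graph_def by blast
qed

end
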